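(* Let $\beta\ge 4\log n$ and let $G$ be the square lattice with vertex set $[n]^2$. Suppose the dynamics is initialized with the identically $+1$ configuration. Then for $A=\{(i,i): i\in[n]\}$, the $A$-corrupted Glauber dynamics at inverse temperature $\beta$ (with the vertices of $A$ fixed to $-1$) reaches the identically $-1$ configuration in expected time $O(n^5)$.
   Context: $[n]=\{1,\dots,n\}$; in $G$ two vertices of $[n]^2$ are adjacent iff they are at Euclidean distance $1$. Configurations are $\sigma\in\{+1,-1\}^{V(G)}$. Glauber dynamics at inverse temperature $\beta$: at each step a vertex $v\in V(G)$ is chosen uniformly at random and its spin is resampled, all other spins being unchanged; the new spin is $+1$ with probability $\frac{e^{\beta s}}{e^{\beta s}+e^{-\beta s}}$ and $-1$ otherwise, where $s=\sum_{u:\,uv\in E(G)}X_t(u)$. The $A$-corrupted Glauber dynamics follows the same transitions, except that the vertices of $A$ are controlled by an adversary, who overrides their updates and can update them at any time; by monotonicity, the paper takes the corrupted vertices to be fixed to the spin $-1$ (from time $0$ on). *)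

theory Defs
  imports "HOL-Probability.Probability"
begin

section \<open>Discrete-time Markov chains on path space\<close>

text \<open>
  The law of the trajectory \<open>X\<^sub>0, X\<^sub>1, \<dots>\<close> of the Markov chain with one-step kernel \<open>K\<close> started
  in \<open>x\<close>, a probability measure on \<open>nat \<Rightarrow> 's\<close>.  It is the Ionescu-Tulcea measure of the
  kernels below: the state at time \<open>0\<close> is \<open>x\<close>, and given the states before time \<open>Suc t\<close>, the
  state at time \<open>Suc t\<close> is drawn from \<open>K\<close> applied to the state at time \<open>t\<close>.
\<close>

fun chain_kernel :: "('s \<Rightarrow> 's pmf) \<Rightarrow> 's \<Rightarrow> nat \<Rightarrow> (nat \<Rightarrow> 's) \<Rightarrow> 's measure" where
  "chain_kernel K x 0 \<omega> = measure_pmf (return_pmf x)"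
| "chain_kernel K x (Suc t) \<omega> = measure_pmf (K (\<omega> t))"

lemma Ionescu_Tulcea_chain_kernel:
  "Ionescu_Tulcea (chain_kernel K x) (\<lambda>_. count_space UNIV)"
proof (rule Ionescu_Tulcea.intro)
  fix i :: nat
  show "chain_kernel K x i \<in> measurable (PiM {0..<i} (\<lambda>_. count_space UNIV)) (subprob_algebra (count_space UNIV))"
  proof (cases i)
    case 0
    have "chain_kernel K x 0 = (\<lambda>\<omega>. measure_pmf (return_pmf x))" by auto
    with 0 show ?thesis by (simp add: measure_pmf_in_subprob_algebra)
  next
    case (Suc t)
    have "(\<lambda>\<omega>. measure_pmf (K (\<omega> t))) \<in>
        measurable (PiM {0..<i} (\<lambda>_. count_space UNIV)) (subprob_algebra (count_space UNIV))"
      by (rule measurable_compose[OF measurable_component_singleton[of t]])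
        (auto simp: Suc measure_pmf_in_subprob_algebra)
    moreover have "chain_kernel K x (Suc t) = (\<lambda>\<omega>. measure_pmf (K (\<omega> t)))" by auto
    ultimately show ?thesis using Suc by simp
  qed
next
  fix i :: nat and \<omega> :: "nat \<Rightarrow> 'a"
  assume "\<omega> \<in> space (PiM {0..<i} (\<lambda>_. count_space UNIV))"
  show "prob_space (chain_kernel K x i \<omega>)"
    by (cases i) (simp_all add: prob_space_measure_pmf)
qed

interpretation chain: Ionescu_Tulcea "chain_kernel K x" "\<lambda>_. count_space UNIV" for K x
  by (rule Ionescu_Tulcea_chain_kernel)

definition chain_law :: "('s \<Rightarrow> 's pmf) \<Rightarrow> 's \<Rightarrow> (nat \<Rightarrow> 's) measure" where
  "chain_law K x = chain.PF.lim K x"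

text \<open>The first time a trajectory is in state \<open>y\<close>; it is \<open>\<infinity>\<close> if \<open>y\<close> is never reached.\<close>

definition hitting_time :: "'s \<Rightarrow> (nat \<Rightarrow> 's) \<Rightarrow> ennreal" where
  "hitting_time y \<omega> = (INF t\<in>{t. \<omega> t = y}. of_nat t)"

definition expected_hitting_time :: "('s \<Rightarrow> 's pmf) \<Rightarrow> 's \<Rightarrow> 's \<Rightarrow> ennreal" where
  "expected_hitting_time K x y = (\<integral>\<^sup>+ \<omega>. hitting_time y \<omega> \<partial>chain_law K x)"

lemma sets_chain_law [measurable_cong]:
  "sets (chain_law K x) = sets (PiM UNIV (\<lambda>_. count_space UNIV))"
  unfolding chain_law_def by simp

lemma space_chain_law [simp]: "space (chain_law K x) = UNIV"
  by (simp add: sets_eq_imp_space_eq[OF sets_chain_law] space_PiM)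

lemma measurable_hitting_time [measurable]:
  "hitting_time y \<in> borel_measurable (PiM UNIV (\<lambda>_. count_space UNIV))"
proof -
  have "hitting_time y = (\<lambda>\<omega>. INF t. if \<omega> t = y then of_nat t else \<top>)"
  proof
    fix \<omega> :: "nat \<Rightarrow> 'a"
    let ?f = "\<lambda>t. if \<omega> t = y then of_nat t else (\<top>::ennreal)"
    show "hitting_time y \<omega> = (INF t. ?f t)"
      unfolding hitting_time_def
    proof (intro antisym INF_greatest)
      show "(INF t\<in>{t. \<omega> t = y}. of_nat t) \<le> ?f t" for t
        by (auto intro: INF_lower)
      show "(INF t. ?f t) \<le> of_nat t" if "t \<in> {t. \<omega> t = y}" for t
        using that INF_lower[of t UNIV ?f] by auto
    qed
  qed
  moreover have "(\<lambda>\<omega>. INF t. if \<omega> t = y then of_nat t else (\<top>::ennreal))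
      \<in> borel_measurable (PiM UNIV (\<lambda>_. count_space UNIV))"
    by measurable
  ultimately show ?thesis by simp
qed

lemma PiE_singletons_iff:
  "g \<in> PiE {0..<Suc t} (\<lambda>i. {p i}) \<longleftrightarrow> (\<forall>i\<le>t. g i = p i) \<and> (\<forall>i>t. g i = undefined)"
  unfolding PiE_iff extensional_def by (auto simp: less_Suc_eq_le)

lemma chain_C_cylinder:
  "emeasure (chain.C K x 0 (Suc t) (\<lambda>_. undefined)) (PiE {0..<Suc t} (\<lambda>i. {p i})) =
     (if p 0 = x then \<Prod>i<t. ennreal (pmf (K (p i)) (p (Suc i))) else 0)"
proof (induction t)
  case 0
  have S: "PiE {0..<Suc 0} (\<lambda>i. {p i}) \<in> sets (PiM {0..<Suc 0} (\<lambda>_. count_space UNIV))"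
    by (rule sets_PiM_I_finite) auto
  have eq: "(\<lambda>y. fun_upd (\<lambda>_. undefined) 0 y) -` PiE {0..<Suc 0} (\<lambda>i. {p i}) = {p 0}"
    by (rule set_eqI) (simp only: vimage_eq PiE_singletons_iff, auto)
  have u: "(\<lambda>_. undefined) \<in> space (PiM {0..<0::nat} (\<lambda>_. count_space UNIV))"
    by (simp add: space_PiM)
  show ?case
    unfolding chain.C.simps add_0_right bind_return[OF chain.measurable_eP[of K x 0] u]
      chain.emeasure_eP[OF u S] space_count_space Int_UNIV_right eq
    by (simp add: emeasure_pmf_single)
next
  case (Suc t)
  let ?M = "\<lambda>m. PiM {0..<m::nat} (\<lambda>_. count_space UNIV)"
  let ?S = "\<lambda>t. PiE {0..<Suc t} (\<lambda>i. {p i})"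
  have S: "?S t \<in> sets (?M (Suc t))" for t
    by (rule sets_PiM_I_finite) auto
  have u: "(\<lambda>_. undefined) \<in> space (?M 0)"
    by (simp add: space_PiM)
  have eP: "emeasure (chain.eP K x (Suc t) \<omega>) (?S (Suc t)) =
      ennreal (pmf (K (p t)) (p (Suc t))) * indicator (?S t) \<omega>"
    if w: "\<omega> \<in> space (?M (Suc t))" for \<omega>
  proof (cases "\<omega> \<in> ?S t")
    case True
    then have "(\<lambda>y. fun_upd \<omega> (Suc t) y) -` ?S (Suc t) = {p (Suc t)}" and "\<omega> t = p t"
      by (auto simp: PiE_singletons_iff le_Suc_eq)
    with True show ?thesis
      by (simp add: chain.emeasure_eP[OF w S] emeasure_pmf_single)
  next
    case False
    then have "(\<lambda>y. fun_upd \<omega> (Suc t) y) -` ?S (Suc t) = {}"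
    proof -
      have "\<omega> \<in> ?S t" if "fun_upd \<omega> (Suc t) y \<in> ?S (Suc t)" for y
      proof -
        have 1: "\<omega> i = p i" if "i \<le> t" for i
          using \<open>fun_upd \<omega> (Suc t) y \<in> ?S (Suc t)\<close> that
          unfolding PiE_singletons_iff by (metis fun_upd_other le_SucI not_less_eq_eq order_refl)
        have 2: "\<omega> i = undefined" if "i > t" for i
          using w that by (simp add: space_PiM PiE_iff extensional_def)
        show ?thesis unfolding PiE_singletons_iff using 1 2 by blast
      qed
      with False show ?thesis by blast
    qed
    with False show ?thesis
      by (simp add: chain.emeasure_eP[OF w S])
  qed
  let ?C = "chain.C K x 0 (Suc t) (\<lambda>_. undefined)"
  have sp: "space ?C = space (?M (Suc t))"
    using chain.space_C[OF u, of K x "Suc t"] by simp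
  have se: "sets ?C = sets (?M (Suc t))"
    using chain.sets_C[OF u, of K x "Suc t"] by simp
  have "emeasure (chain.C K x 0 (Suc (Suc t)) (\<lambda>_. undefined)) (?S (Suc t)) =
      emeasure (?C \<bind> chain.eP K x (Suc t)) (?S (Suc t))"
    by simp
  also have "\<dots> = (\<integral>\<^sup>+\<omega>. emeasure (chain.eP K x (Suc t) \<omega>) (?S (Suc t)) \<partial>?C)"
  proof (rule emeasure_bind[OF _ _ S])
    show "space ?C \<noteq> {}"
      unfolding sp by (rule prob_space.not_empty[OF chain.prob_space_C[OF u, of K x "Suc t"], unfolded chain.space_C[OF u] add_0])
    show "chain.eP K x (Suc t) \<in> ?C \<rightarrow>\<^sub>M subprob_algebra (?M (Suc (Suc t)))"
      using chain.measurable_eP[of K x "Suc t"] by (simp only: measurable_cong_sets[OF se refl])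
  qed
  also have "\<dots> = (\<integral>\<^sup>+\<omega>. ennreal (pmf (K (p t)) (p (Suc t))) * indicator (?S t) \<omega> \<partial>?C)"
    by (intro nn_integral_cong eP) (simp only: sp)
  also have "\<dots> = ennreal (pmf (K (p t)) (p (Suc t))) * emeasure ?C (?S t)"
    by (rule nn_integral_cmult_indicator) (simp only: se S)
  also have "\<dots> = (if p 0 = x then \<Prod>i<Suc t. ennreal (pmf (K (p i)) (p (Suc i))) else 0)"
    unfolding Suc.IH by (simp add: mult.commute)
  finally show ?case .
qed

text \<open>The finite-dimensional distributions are those of the Markov chain.\<close>

lemma chain_law_cylinder:
  "emeasure (chain_law K x) {\<omega>. \<forall>i\<le>t. \<omega> i = p i} =
     (if p 0 = x then \<Prod>i<t. ennreal (pmf (K (p i)) (p (Suc i))) else 0)"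
proof -
  let ?S = "PiE {0..<Suc t} (\<lambda>i. {p i})"
  have S: "?S \<in> sets (PiM {0..<Suc t} (\<lambda>_. count_space UNIV))"
    by (rule sets_PiM_I_finite) auto
  have "{\<omega>. \<forall>i\<le>t. \<omega> i = p i} = prod_emb UNIV (\<lambda>_. count_space UNIV) {0..<Suc t} ?S"
    by (auto simp: prod_emb_def PiE_iff less_Suc_eq_le)
  moreover have "prod_emb {0..<Suc t} (\<lambda>_. count_space UNIV) {0..<Suc t} ?S = ?S"
    by (rule prod_emb_id) auto
  ultimately show ?thesis
    unfolding chain_law_def
    using chain.lim[OF _ S, of K x] chain.emeasure_CI[OF subset_refl S, of K x]
      chain_C_cylinder[of K x t p]
    by simp
qed


section \<open>Glauber dynamics\<close>

text \<open>
  A graph is given by its vertex set \<open>V\<close> and its adjacency relation.  A configuration is a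
  function \<open>'v \<Rightarrow> int\<close> with values \<open>1\<close> and \<open>-1\<close> on \<open>V\<close> (and \<open>undefined\<close> outside \<open>V\<close>, so that
  configurations on \<open>V\<close> are equal iff they agree on \<open>V\<close>).
\<close>

definition const_config :: "'v set \<Rightarrow> int \<Rightarrow> 'v \<Rightarrow> int" where
  "const_config V c = (\<lambda>v\<in>V. c)"

definition local_field :: "'v set \<Rightarrow> ('v \<Rightarrow> 'v \<Rightarrow> bool) \<Rightarrow> ('v \<Rightarrow> int) \<Rightarrow> 'v \<Rightarrow> int" where
  "local_field V adj \<sigma> v = (\<Sum>u\<in>{u\<in>V. adj u v}. \<sigma> u)"

definition plus_prob :: "real \<Rightarrow> int \<Rightarrow> real" where
  "plus_prob \<beta> s =
     exp (\<beta> * of_int s) / (exp (\<beta> * of_int s) + exp (- (\<beta> * of_int s)))"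

definition glauber_step ::
  "'v set \<Rightarrow> ('v \<Rightarrow> 'v \<Rightarrow> bool) \<Rightarrow> real \<Rightarrow> ('v \<Rightarrow> int) \<Rightarrow> ('v \<Rightarrow> int) pmf" where
  "glauber_step V adj \<beta> \<sigma> = do {
     v \<leftarrow> pmf_of_set V;
     b \<leftarrow> bernoulli_pmf (plus_prob \<beta> (local_field V adj \<sigma> v));
     return_pmf (\<sigma>(v := (if b then 1 else -1)))
   }"

text \<open>
  The corrupted dynamics makes the same transitions, vertices of \<open>A\<close> being selected like all the
  others, but the spins on \<open>A\<close> are overridden by \<open>-1\<close>.
\<close>

definition corrupt :: "'v set \<Rightarrow> ('v \<Rightarrow> int) \<Rightarrow> 'v \<Rightarrow> int" where
  "corrupt A \<sigma> = (\<lambda>v. if v \<in> A then -1 else \<sigma> v)"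

definition corrupted_glauber_step ::
  "'v set \<Rightarrow> ('v \<Rightarrow> 'v \<Rightarrow> bool) \<Rightarrow> real \<Rightarrow> 'v set \<Rightarrow> ('v \<Rightarrow> int) \<Rightarrow> ('v \<Rightarrow> int) pmf" where
  "corrupted_glauber_step V adj \<beta> A \<sigma> = map_pmf (corrupt A) (glauber_step V adj \<beta> \<sigma>)"


section \<open>The square lattice\<close>

definition lattice_verts :: "nat \<Rightarrow> (nat \<times> nat) set" where
  "lattice_verts n = {1..n} \<times> {1..n}"

text \<open>The distance on \<^typ>\<open>real \<times> real\<close> is the Euclidean one.\<close>

definition lattice_adj :: "nat \<times> nat \<Rightarrow> nat \<times> nat \<Rightarrow> bool" where
  "lattice_adj u v \<longleftrightarrow>
     dist (real (fst u), real (snd u)) (real (fst v), real (snd v)) = 1"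

definition diagonal :: "nat \<Rightarrow> (nat \<times> nat) set" where
  "diagonal n = {(i, i) | i. i \<in> {1..n}}"

end

theory Submission
  imports Defs
begin

text \<open>
  The diagonal cuts the square into two triangles.  In the triangle \<open>i < j\<close>, replace the set of plus
  spins by the order ideal that it generates towards the corner \<open>(1, n)\<close>, and treat the other
  triangle by transposition; let the potential be the total size of the two ideals.
  A site outside the ideal enlarges it with a non-negligible probability only if both of its
  neighbours towards the corner are in the ideal; then its local field is at most \<open>0\<close>, it is selected
  and turned to plus with probability at most \<open>1 / (2 n\<^sup>2)\<close>, and the ideal grows by one site.  Any other
  site outside has local field at most \<open>-1\<close>, hence becomes plus with probability at most
  \<open>exp (- 2 \<beta>) \<le> n powr (-8)\<close> when selected.  Conversely a minimal site of the ideal is a plus site with local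
  field at most \<open>0\<close>, and turning it to minus shrinks the ideal.  Since an ideal has more minimal sites
  than sites at which it can grow, the potential has drift at most \<open>- 1 / (4 n\<^sup>2)\<close> from every
  configuration other than the target.  As it is at most \<open>2 n\<^sup>2\<close>, the expected hitting time is even \<open>O(n\<^sup>4)\<close>.
\<close>

section \<open>Expected hitting times from a negative drift\<close>

text \<open>The series counts the times through which \<open>y\<close> has not been visited, so its
  expectation is the sum of the survival probabilities. If \<open>y\<close> is never visited, every
  term is 1 and the series diverges.\<close>

lemma hitting_time_le_suminf:
  "hitting_time y \<omega> \<le> (\<Sum>t. indicator {\<omega>. \<forall>i\<le>t. \<omega> i \<noteq> y} \<omega>)"
proof (cases "\<exists>t. \<omega> t = y")
  case True
  define T where "T = (LEAST t. \<omega> t = y)"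
  have "\<omega> T = y" using True unfolding T_def by (rule LeastI_ex)
  then have "hitting_time y \<omega> \<le> of_nat T"
    unfolding hitting_time_def by (auto intro: INF_lower)
  also have "\<dots> = (\<Sum>t<T. 1)" by simp
  also have "\<dots> = (\<Sum>t<T. indicator {\<omega>. \<forall>i\<le>t. \<omega> i \<noteq> y} \<omega>)"
  proof (rule sum.cong)
    fix t assume "t \<in> {..<T}"
    then have "\<omega> i \<noteq> y" if "i \<le> t" for i
      using not_less_Least[of i "\<lambda>t. \<omega> t = y"] that unfolding T_def by auto
    then show "(1::ennreal) = indicator {\<omega>. \<forall>i\<le>t. \<omega> i \<noteq> y} \<omega>" by simp
  qed simp
  also have "\<dots> \<le> (\<Sum>t. indicator {\<omega>. \<forall>i\<le>t. \<omega> i \<noteq> y} \<omega>)"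
    by (rule sum_le_suminf) auto
  finally show ?thesis .
next
  case False
  then have "(\<Sum>t. indicator {\<omega>. \<forall>i\<le>t. \<omega> i \<noteq> y} \<omega> :: ennreal) = (\<Sum>t::nat. 1)"
    by (intro suminf_cong) auto
  also have "\<dots> = \<top>"
    using nn_integral_count_space_nat[of "\<lambda>_. 1"] by simp
  finally show ?thesis by simp
qed

text \<open>Additive drift theorem: before \<open>y\<close> is hit, each step lowers the mean of
  \<open>f\<close> by at least \<open>c\<close>, and \<open>f\<close> is nonnegative, so
  \<open>c\<close> times the sum of the survival probabilities stays below \<open>f x\<close>.
  Infinite values of \<open>f\<close> make it possible to exclude states.\<close>

lemma expected_hitting_time_drift:
  fixes f :: "'s \<Rightarrow> ennreal"
  assumes drift: "\<And>s. s \<noteq> y \<Longrightarrow> (\<integral>\<^sup>+ s'. f s' \<partial>measure_pmf (K s)) + c \<le> f s"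
  shows "c * expected_hitting_time K x y \<le> f x"
proof -
  let ?M = "\<lambda>m. PiM {0..<m::nat} (\<lambda>_. count_space (UNIV::'s set))"
  let ?C = "\<lambda>t. chain.C K x 0 (Suc t) (\<lambda>_. undefined)"
  \<comment> \<open>The argument runs on path prefixes: \<open>?C t\<close> is the law of the
    coordinates 0 to \<open>t\<close>, \<open>A t\<close> is survival through time \<open>t\<close>,
    and \<open>a t\<close> is the mean of \<open>f\<close> at time \<open>t\<close> on that
    event.\<close>
  define A where "A t = {\<omega> \<in> space (?M (Suc t)). \<forall>i\<le>t. \<omega> i \<noteq> y}" for t
  define p where "p t = emeasure (?C t) (A t)" for t
  define a where "a t = (\<integral>\<^sup>+\<omega>. f (\<omega> t) * indicator (A t) \<omega> \<partial>?C t)" for t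
  have u: "(\<lambda>_. undefined) \<in> space (?M 0)"
    by (simp add: space_PiM)
  have seC: "sets (chain.C K x 0 m (\<lambda>_. undefined)) = sets (?M m)" for m
    using chain.sets_C[OF u, of K x m] by simp
  have sp: "space (?C t) = space (?M (Suc t))" for t
    using chain.space_C[OF u, of K x "Suc t"] by simp
  have se: "sets (?C t) = sets (?M (Suc t))" for t
    using chain.sets_C[OF u, of K x "Suc t"] by simp
  have coord: "(\<lambda>\<omega>. g (\<omega> i)) \<in> borel_measurable (?M (Suc t))" if "i \<le> t" for g :: "'s \<Rightarrow> ennreal" and i t
    by (rule measurable_compose[OF measurable_component_singleton]) (use that in auto)
  have A: "A t \<in> sets (?M (Suc t))" for t
  proof -
    have "A t = (\<Inter>i\<in>{..t}. (\<lambda>\<omega>. \<omega> i) -` (- {y}) \<inter> space (?M (Suc t)))"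
      by (auto simp: A_def)
    also have "\<dots> \<in> sets (?M (Suc t))"
      by (intro sets.finite_INT measurable_sets[OF measurable_component_singleton]) auto
    finally show ?thesis .
  qed
  have m: "(\<lambda>\<omega>. g (\<omega> i) * indicator (A t) \<omega>) \<in> borel_measurable (?M (Suc t))"
    if "i \<le> t" for g :: "'s \<Rightarrow> ennreal" and i t
    by (intro borel_measurable_times_ennreal coord that borel_measurable_indicator A)
  \<comment> \<open>Conditioning on the first \<open>m\<close> coordinates: the next one is drawn
    from the kernel and integrated first.\<close>
  have bind: "(\<integral>\<^sup>+\<omega>. g \<omega> \<partial>chain.C K x 0 (Suc m) (\<lambda>_. undefined)) =
      (\<integral>\<^sup>+\<omega>. \<integral>\<^sup>+z. g (fun_upd \<omega> m z) \<partial>chain_kernel K x m \<omega> \<partial>chain.C K x 0 m (\<lambda>_. undefined))"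
    if g: "g \<in> borel_measurable (?M (Suc m))" for g :: "_ \<Rightarrow> ennreal" and m
  proof -
    have "(\<integral>\<^sup>+\<omega>. g \<omega> \<partial>chain.C K x 0 (Suc m) (\<lambda>_. undefined)) =
        (\<integral>\<^sup>+\<omega>. \<integral>\<^sup>+\<omega>'. g \<omega>' \<partial>chain.eP K x m \<omega> \<partial>chain.C K x 0 m (\<lambda>_. undefined))"
      unfolding chain.C.simps add_0
    proof (rule nn_integral_bind[OF g])
      show "chain.eP K x m \<in> chain.C K x 0 m (\<lambda>_. undefined) \<rightarrow>\<^sub>M subprob_algebra (?M (Suc m))"
        using chain.measurable_eP[of K x m]
        by (simp only: measurable_cong_sets[OF seC refl])
    qed
    also have "\<dots> = (\<integral>\<^sup>+\<omega>. \<integral>\<^sup>+z. g (fun_upd \<omega> m z) \<partial>chain_kernel K x m \<omega> \<partial>chain.C K x 0 m (\<lambda>_. undefined))"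
      by (intro nn_integral_cong chain.nn_integral_eP g)
        (simp add: chain.space_C[OF u])
    finally show ?thesis .
  qed
  have a0: "a 0 \<le> f x"
  proof -
    have "a 0 = (\<integral>\<^sup>+\<omega>. f x * indicator (A 0) (fun_upd \<omega> 0 x) \<partial>chain.C K x 0 0 (\<lambda>_. undefined))"
      unfolding a_def by (subst bind[OF m]) (auto simp: nn_integral_return)
    also have "\<dots> \<le> (\<integral>\<^sup>+\<omega>. f x \<partial>chain.C K x 0 0 (\<lambda>_. undefined))"
      by (intro nn_integral_mono) (auto simp: indicator_def)
    also have "\<dots> = f x"
      using prob_space.emeasure_space_1[OF chain.prob_space_C[OF u, of K x 0]] by simp
    finally show ?thesis .
  qed
  \<comment> \<open>Survival through \<open>Suc t\<close> entails survival through \<open>t\<close>,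
    and on \<open>A t\<close> the state at time \<open>t\<close> differs from \<open>y\<close>, so
    the drift hypothesis bounds the inner integral.\<close>
  have step: "c * p t + a (Suc t) \<le> a t" for t
  proof -
    have "c * p t + a (Suc t) = (\<integral>\<^sup>+\<omega>. c * indicator (A t) \<omega> \<partial>?C t) +
        (\<integral>\<^sup>+\<omega>. \<integral>\<^sup>+z. f z * indicator (A (Suc t)) (fun_upd \<omega> (Suc t) z) \<partial>measure_pmf (K (\<omega> t)) \<partial>?C t)"
      unfolding a_def p_def
      by (subst bind[OF m], simp) (simp add: nn_integral_cmult_indicator se A del: chain.C.simps)
    also have "\<dots> \<le> (\<integral>\<^sup>+\<omega>. c * indicator (A t) \<omega> \<partial>?C t) +
        (\<integral>\<^sup>+\<omega>. (\<integral>\<^sup>+z. f z \<partial>measure_pmf (K (\<omega> t))) * indicator (A t) \<omega> \<partial>?C t)"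
    proof (intro add_left_mono nn_integral_mono)
      fix \<omega> assume w: "\<omega> \<in> space (?C t)"
      have "indicator (A (Suc t)) (fun_upd \<omega> (Suc t) z) \<le> (indicator (A t) \<omega> :: ennreal)" for z
      proof -
        have "\<omega> i \<noteq> y" if "\<forall>i\<le>Suc t. (fun_upd \<omega> (Suc t) z) i \<noteq> y" "i \<le> t" for i
          using that(1)[rule_format, of i] that(2) by auto
        with w show ?thesis
          unfolding sp by (auto simp: A_def split: split_indicator)
      qed
      then have "(\<integral>\<^sup>+z. f z * indicator (A (Suc t)) (fun_upd \<omega> (Suc t) z) \<partial>measure_pmf (K (\<omega> t)))
          \<le> (\<integral>\<^sup>+z. f z * indicator (A t) \<omega> \<partial>measure_pmf (K (\<omega> t)))"
        by (intro nn_integral_mono mult_left_mono) auto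
      also have "\<dots> = (\<integral>\<^sup>+z. f z \<partial>measure_pmf (K (\<omega> t))) * indicator (A t) \<omega>"
        by (simp add: nn_integral_multc)
      finally show "(\<integral>\<^sup>+z. f z * indicator (A (Suc t)) (fun_upd \<omega> (Suc t) z) \<partial>measure_pmf (K (\<omega> t)))
          \<le> (\<integral>\<^sup>+z. f z \<partial>measure_pmf (K (\<omega> t))) * indicator (A t) \<omega>" .
    qed
    also have "\<dots> = (\<integral>\<^sup>+\<omega>. c * indicator (A t) \<omega> +
        (\<integral>\<^sup>+z. f z \<partial>measure_pmf (K (\<omega> t))) * indicator (A t) \<omega> \<partial>?C t)"
      using m[of t t "\<lambda>_. c"] m[of t t "\<lambda>s. \<integral>\<^sup>+z. f z \<partial>measure_pmf (K s)"]
      by (intro nn_integral_add[symmetric]) (simp_all only: measurable_cong_sets[OF se refl] order_refl)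
    also have "\<dots> \<le> a t"
      unfolding a_def
    proof (intro nn_integral_mono)
      fix \<omega>
      show "c * indicator (A t) \<omega> + (\<integral>\<^sup>+z. f z \<partial>measure_pmf (K (\<omega> t))) * indicator (A t) \<omega>
          \<le> f (\<omega> t) * indicator (A t) \<omega>"
        using drift[of "\<omega> t"] by (auto simp: A_def add.commute split: split_indicator)
    qed
    finally show ?thesis .
  qed
  \<comment> \<open>The inequalities \<open>step\<close> telescope; the leftover \<open>a T\<close>
    is nonnegative and is dropped at the end.\<close>
  have partial: "c * (\<Sum>t<T. p t) + a T \<le> f x" for T
  proof (induction T)
    case 0
    then show ?case using a0 by simp
  next
    case (Suc T)
    have "c * (\<Sum>t<Suc T. p t) + a (Suc T) = c * (\<Sum>t<T. p t) + (c * p T + a (Suc T))"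
      by (simp add: distrib_left add.assoc)
    also have "\<dots> \<le> c * (\<Sum>t<T. p t) + a T"
      by (intro add_left_mono step)
    finally show ?case using Suc by order
  qed
  \<comment> \<open>Survival through \<open>t\<close> depends on finitely many coordinates, so the
    path law gives it the same probability as the prefix law.\<close>
  have surv: "emeasure (chain_law K x) {\<omega>. \<forall>i\<le>t. \<omega> i \<noteq> y} = p t" for t
  proof -
    have eq: "{\<omega>. \<forall>i\<le>t. \<omega> i \<noteq> y} = prod_emb UNIV (\<lambda>_. count_space UNIV) {0..<Suc t} (A t)"
      by (auto simp: prod_emb_def A_def space_PiM PiE_iff less_Suc_eq_le)
    have "prod_emb {0..<Suc t} (\<lambda>_. count_space UNIV) {0..<Suc t} (A t) = A t"
      by (rule prod_emb_id) (auto simp: A_def space_PiM)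
    then show ?thesis
      unfolding eq chain_law_def p_def
      using chain.lim[OF _ A, of t K x] chain.emeasure_CI[OF subset_refl A, of K x]
      by simp
  qed
  have S: "{\<omega>. \<forall>i\<le>t. \<omega> i \<noteq> y} \<in> sets (chain_law K x)" for t
  proof -
    have "{\<omega>. \<forall>i\<le>t. \<omega> i \<noteq> y} = prod_emb UNIV (\<lambda>_. count_space UNIV) {0..<Suc t} (A t)"
      by (auto simp: prod_emb_def A_def space_PiM PiE_iff less_Suc_eq_le)
    also have "\<dots> \<in> sets (chain_law K x)"
      unfolding sets_chain_law using A by (intro measurable_prod_emb) auto
    finally show ?thesis .
  qed
  have "expected_hitting_time K x y \<le>
      (\<integral>\<^sup>+\<omega>. (\<Sum>t. indicator {\<omega>. \<forall>i\<le>t. \<omega> i \<noteq> y} \<omega>) \<partial>chain_law K x)"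
    unfolding expected_hitting_time_def by (intro nn_integral_mono hitting_time_le_suminf)
  also have "\<dots> = (\<Sum>t. p t)"
    using S by (subst nn_integral_suminf) (auto simp: surv)
  finally have "c * expected_hitting_time K x y \<le> c * (\<Sum>t. p t)"
    by (rule mult_left_mono) simp
  also have "\<dots> = (\<Sum>t. c * p t)"
    by simp
  also have "\<dots> \<le> f x"
  proof (rule suminf_le_const)
    show "(\<Sum>t<T. c * p t) \<le> f x" for T
      using partial[of T] order_trans[OF add_increasing2[OF zero_le order_refl]]
      by (simp add: sum_distrib_left)
  qed simp
  finally show ?thesis .
qed

section \<open>Corners of the hull\<close>

definition update_at :: "'v set \<Rightarrow> ('v \<Rightarrow> int) \<Rightarrow> 'v \<Rightarrow> bool \<Rightarrow> 'v \<Rightarrow> int" where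
  "update_at A \<sigma> v b = corrupt A (\<sigma>(v := (if b then 1 else -1)))"

text \<open>An invariant set of the dynamics. Extensionality makes the all-minus configuration its
  only element without a plus spin.\<close>

definition configs :: "nat \<Rightarrow> (nat \<times> nat \<Rightarrow> int) set" where
  "configs n = {\<sigma> \<in> extensional (lattice_verts n).
     (\<forall>v\<in>lattice_verts n. \<sigma> v \<in> {1, -1}) \<and> (\<forall>v\<in>diagonal n. \<sigma> v = -1)}"

definition plus_set :: "nat \<Rightarrow> (nat \<times> nat \<Rightarrow> int) \<Rightarrow> (nat \<times> nat) set" where
  "plus_set n \<sigma> = {v \<in> lattice_verts n. \<sigma> v = 1}"

text \<open>A Young diagram in the corner \<open>(1, n)\<close>. The condition \<open>a < b\<close>
  discards generators on or below the diagonal; those below are seen through the transposed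
  configuration.\<close>

definition corner_hull :: "nat \<Rightarrow> (nat \<times> nat) set \<Rightarrow> (nat \<times> nat) set" where
  "corner_hull n P = {(i, j). 1 \<le> i \<and> j \<le> n \<and> (\<exists>(a, b)\<in>P. a < b \<and> i \<le> a \<and> b \<le> j)}"

definition removable :: "(nat \<times> nat) set \<Rightarrow> (nat \<times> nat) set" where
  "removable H = {(i, j). (i, j) \<in> H \<and> (i, j - 1) \<notin> H \<and> (i + 1, j) \<notin> H}"

text \<open>For a hull, sites of the first row or the last column never count, even where adding one
  leaves an ideal: outside the square they have a missing neighbour, which keeps the local field
  negative. This is why addable corners are fewer than removable ones.\<close>

definition addable :: "(nat \<times> nat) set \<Rightarrow> (nat \<times> nat) set" where
  "addable H = {(i, j). (i, j) \<notin> H \<and> (i - 1, j) \<in> H \<and> (i, j + 1) \<in> H}"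

lemma finite_lattice_verts [simp]: "finite (lattice_verts n)"
  by (simp add: lattice_verts_def)

lemma card_lattice_verts [simp]: "card (lattice_verts n) = n\<^sup>2"
  by (simp add: lattice_verts_def power2_eq_square)

lemma hull_upper: "(i, j) \<in> corner_hull n P \<Longrightarrow> 1 \<le> i \<and> i < j \<and> j \<le> n"
  by (auto simp: corner_hull_def)

lemma hull_subset: "corner_hull n P \<subseteq> lattice_verts n"
  by (auto simp: lattice_verts_def dest: hull_upper)

lemma finite_hull [simp]: "finite (corner_hull n P)"
  by (rule finite_subset[OF hull_subset]) simp

lemma hull_mono: "P \<subseteq> Q \<Longrightarrow> corner_hull n P \<subseteq> corner_hull n Q"
  by (fastforce simp: corner_hull_def)

lemma hull_closed:
  "(i, j) \<in> corner_hull n P \<Longrightarrow> 1 \<le> i' \<Longrightarrow> i' \<le> i \<Longrightarrow> j \<le> j' \<Longrightarrow> j' \<le> n \<Longrightarrow> (i', j') \<in> corner_hull n P"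
  by (fastforce simp: corner_hull_def)

lemma in_hull: "(i, j) \<in> P \<Longrightarrow> 1 \<le> i \<Longrightarrow> i < j \<Longrightarrow> j \<le> n \<Longrightarrow> (i, j) \<in> corner_hull n P"
  by (auto simp: corner_hull_def)

text \<open>Generating an ideal is idempotent: a new generator already in the hull adds nothing, and
  one on or below the diagonal is ignored.\<close>

lemma hull_eqI:
  assumes sub: "P \<subseteq> Q"
    and new: "\<And>i j. (i, j) \<in> Q - P \<Longrightarrow> i < j \<Longrightarrow> (i, j) \<in> corner_hull n P"
  shows "corner_hull n Q = corner_hull n P"
proof
  show "corner_hull n Q \<subseteq> corner_hull n P"
  proof
    fix u assume "u \<in> corner_hull n Q"
    then obtain i j a b where u: "u = (i, j)" "1 \<le> i" "j \<le> n"
      and ab: "(a, b) \<in> Q" "a < b" "i \<le> a" "b \<le> j"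
      by (auto simp: corner_hull_def)
    have "(a, b) \<in> corner_hull n P"
      using u ab new[of a b] by (cases "(a, b) \<in> P") (auto intro: in_hull)
    then show "u \<in> corner_hull n P"
      unfolding u by (rule hull_closed) (use u ab in auto)
  qed
qed (rule hull_mono[OF sub])

lemma card_hull_le: "card (corner_hull n P) \<le> n\<^sup>2"
  using card_mono[OF _ hull_subset, of n P] by simp

text \<open>Two addable corners never share a row, and the row above an addable corner contains a removable
  one; the last row of the hull contains a removable corner that is not obtained in this way.\<close>

lemma card_addable_less_card_removable:
  assumes "corner_hull n P \<noteq> {}"
  shows "card (addable (corner_hull n P)) < card (removable (corner_hull n P))"
proof -
  let ?H = "corner_hull n P"
  have fin: "finite (removable ?H)"
    by (rule finite_subset[of _ ?H]) (auto simp: removable_def)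
  \<comment> \<open>The least column \<open>c\<close> of row \<open>i\<close> in the hull gives a
    removable corner: were \<open>(i + 1, c)\<close> in the hull, closure would put
    \<open>(i + 1, j)\<close> there too, as \<open>c \<le> j\<close>.\<close>
  have row: "i \<in> fst ` removable ?H" if "(i, j) \<in> ?H" "(i + 1, j) \<notin> ?H" for i j
  proof -
    define c where "c = (LEAST j. (i, j) \<in> ?H)"
    have c: "(i, c) \<in> ?H" unfolding c_def by (rule LeastI) (fact that)
    have "c \<le> j" unfolding c_def by (rule Least_le) (fact that)
    have "(i, c - 1) \<notin> ?H"
    proof
      assume "(i, c - 1) \<in> ?H"
      then have "c \<le> c - 1" unfolding c_def by (rule Least_le)
      then show False using hull_upper[OF c] by linarith
    qed
    moreover have "(i + 1, c) \<notin> ?H"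
      using hull_closed[of "i + 1" c n P "i + 1" j] that \<open>c \<le> j\<close> hull_upper[OF that(1)] by auto
    ultimately have "(i, c) \<in> removable ?H" using c by (simp add: removable_def)
    then show ?thesis by force
  qed
  define m where "m = Max (fst ` ?H)"
  have "m \<in> fst ` ?H" unfolding m_def using assms by (intro Max_in) auto
  then obtain j where j: "(m, j) \<in> ?H" by auto
  have m_max: "i \<le> m" if "(i, k) \<in> ?H" for i k
    unfolding m_def using that by (intro Max_ge) force+
  have m: "m \<in> fst ` removable ?H"
    using m_max[of "m + 1"] by (intro row[OF j]) auto
  \<comment> \<open>If \<open>(i, j)\<close> and \<open>(i, k)\<close> are addable and
    \<open>j < k\<close>, then \<open>(i, j + 1)\<close> is in the hull, and closure puts
    \<open>(i, k)\<close> there as well, a contradiction.\<close>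
  have inj: "inj_on fst (addable ?H)"
  proof -
    have False if "(i, j) \<in> addable ?H" "(i, k) \<in> addable ?H" "j < k" for i j k
      using that hull_closed[of i "j + 1" n P i k] hull_upper[of i "j + 1" n P]
        hull_upper[of "i - 1" k n P] by (auto simp: addable_def)
    then show ?thesis by (auto simp: inj_on_def) (metis nat_neq_iff)
  qed
  \<comment> \<open>Row \<open>m\<close> is left out because an addable corner in row
    \<open>m + 1\<close> would have its neighbour \<open>(m + 1, j + 1)\<close> in the hull, beyond
    the last row.\<close>
  have sub: "fst ` addable ?H \<subseteq> Suc ` (fst ` removable ?H - {m})"
  proof
    fix i assume "i \<in> fst ` addable ?H"
    then obtain j where ij: "(i, j) \<notin> ?H" "(i - 1, j) \<in> ?H" "(i, j + 1) \<in> ?H"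
      by (auto simp: addable_def)
    have i: "Suc (i - 1) = i" using hull_upper[OF ij(2)] by linarith
    then have "i - 1 \<in> fst ` removable ?H" using ij by (intro row[of _ j]) auto
    moreover have "i - 1 \<noteq> m" using m_max[OF ij(3)] i by auto
    ultimately show "i \<in> Suc ` (fst ` removable ?H - {m})"
      using i by (metis DiffI image_eqI singletonD)
  qed
  have "card (addable ?H) = card (fst ` addable ?H)" by (simp add: card_image inj)
  also have "\<dots> \<le> card (Suc ` (fst ` removable ?H - {m}))" using fin by (intro card_mono sub) auto
  also have "\<dots> = card (fst ` removable ?H - {m})" by (simp add: card_image)
  also have "\<dots> < card (fst ` removable ?H)" using fin m by (intro card_Diff1_less) auto
  also have "\<dots> \<le> card (removable ?H)" using fin by (rule card_image_le)
  finally show ?thesis .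
qed

section \<open>Lattice neighbours and the local field above the diagonal\<close>

lemma lattice_adj_iff:
  "lattice_adj (a, b) (i, j) \<longleftrightarrow>
     (a, b) = (i + 1, j) \<or> (i, j) = (a + 1, b) \<or> (a, b) = (i, j + 1) \<or> (i, j) = (a, b + 1)"
proof -
  have "lattice_adj (a, b) (i, j) \<longleftrightarrow> (real a - real i)\<^sup>2 + (real b - real j)\<^sup>2 = 1"
    by (simp add: lattice_adj_def dist_Pair_Pair dist_real_def)
  \<comment> \<open>Over the integers two squares with sum 1 come from differences in {-1, 0, 1},
    which leaves finitely many cases.\<close>
  also have "\<dots> \<longleftrightarrow> (int a - int i)\<^sup>2 + (int b - int j)\<^sup>2 = 1"
  proof -
    have "(real a - real i)\<^sup>2 + (real b - real j)\<^sup>2 = of_int ((int a - int i)\<^sup>2 + (int b - int j)\<^sup>2)"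
      by simp
    then show ?thesis by (simp only: of_int_eq_1_iff)
  qed
  also have "\<dots> \<longleftrightarrow> (a, b) = (i + 1, j) \<or> (i, j) = (a + 1, b) \<or> (a, b) = (i, j + 1) \<or> (i, j) = (a, b + 1)"
  proof
    assume h: "(int a - int i)\<^sup>2 + (int b - int j)\<^sup>2 = 1"
    have 1: "\<bar>x\<bar> \<le> 1" if "x\<^sup>2 + y\<^sup>2 = 1" for x y :: int
      using that by (intro abs_square_le_1[THEN iffD1]) (smt (verit) zero_le_power2)
    have "\<bar>int a - int i\<bar> \<le> 1" "\<bar>int b - int j\<bar> \<le> 1"
      using 1[OF h] 1[of "int b - int j" "int a - int i"] h by (auto simp: add.commute)
    then have "int a - int i \<in> {-1, 0, 1}" "int b - int j \<in> {-1, 0, 1}" by auto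
    with h show "(a, b) = (i + 1, j) \<or> (i, j) = (a + 1, b) \<or> (a, b) = (i, j + 1) \<or> (i, j) = (a, b + 1)"
      by auto
  qed auto
  finally show ?thesis .
qed

text \<open>As \<open>i < j\<close>, both neighbours towards the diagonal lie in the square and
  contribute -2 in total. The other two contribute at most 2, and at most 1 if one of them is minus
  or missing.\<close>

lemma local_field_upper:
  assumes \<sigma>: "\<sigma> \<in> configs n" and v: "1 \<le> i" "i < j" "j \<le> n"
    and minus: "(i + 1, j) \<notin> plus_set n \<sigma>" "(i, j - 1) \<notin> plus_set n \<sigma>"
  shows "local_field (lattice_verts n) lattice_adj \<sigma> (i, j) \<le> 0"
    and "(i - 1, j) \<notin> plus_set n \<sigma> \<or> (i, j + 1) \<notin> plus_set n \<sigma> \<Longrightarrow>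
      local_field (lattice_verts n) lattice_adj \<sigma> (i, j) \<le> -1"
proof -
  let ?V = "lattice_verts n"
  \<comment> \<open>Extension by 0 lets all four neighbours be summed even at the boundary, where
    \<open>i - 1 = 0\<close> or \<open>j + 1 = n + 1\<close> leaves the square.\<close>
  define g where "g u = (if u \<in> ?V then \<sigma> u else 0)" for u
  have "{u \<in> ?V. lattice_adj u (i, j)} = ?V \<inter> {(i + 1, j), (i, j - 1), (i - 1, j), (i, j + 1)}"
    using v by (auto simp: lattice_adj_iff)
  then have "local_field ?V lattice_adj \<sigma> (i, j) =
      (\<Sum>u\<in>{(i + 1, j), (i, j - 1), (i - 1, j), (i, j + 1)} \<inter> ?V. \<sigma> u)"
    by (simp add: local_field_def Int_commute)
  also have "\<dots> = (\<Sum>u\<in>{(i + 1, j), (i, j - 1), (i - 1, j), (i, j + 1)}. g u)"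
    unfolding g_def by (subst sum.inter_restrict) auto
  also have "\<dots> = g (i + 1, j) + g (i, j - 1) + g (i - 1, j) + g (i, j + 1)"
    using v by simp
  finally have field: "local_field ?V lattice_adj \<sigma> (i, j) =
      g (i + 1, j) + g (i, j - 1) + g (i - 1, j) + g (i, j + 1)" .
  have le: "g u \<le> 1" and le0: "u \<notin> plus_set n \<sigma> \<Longrightarrow> g u \<le> 0" for u
    using \<sigma> by (auto simp: g_def configs_def plus_set_def)
  have "(i + 1, j) \<in> ?V" "(i, j - 1) \<in> ?V"
    using v by (auto simp: lattice_verts_def)
  then have "g (i + 1, j) = -1" "g (i, j - 1) = -1"
    using \<sigma> minus by (auto simp: g_def configs_def plus_set_def)
  then show "local_field ?V lattice_adj \<sigma> (i, j) \<le> 0"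
    and "(i - 1, j) \<notin> plus_set n \<sigma> \<or> (i, j + 1) \<notin> plus_set n \<sigma> \<Longrightarrow>
      local_field ?V lattice_adj \<sigma> (i, j) \<le> -1"
    unfolding field using le[of "(i - 1, j)"] le[of "(i, j + 1)"] le0[of "(i - 1, j)"] le0[of "(i, j + 1)"]
    by auto
qed

section \<open>Bounds on the probability of a plus update\<close>

lemma plus_prob_eq: "plus_prob \<beta> s = 1 / (1 + exp (- 2 * \<beta> * of_int s))"
proof -
  have "exp (\<beta> * of_int s) + exp (- (\<beta> * of_int s)) = exp (\<beta> * of_int s) * (1 + exp (- 2 * \<beta> * of_int s))"
    by (simp add: distrib_left flip: exp_add)
  then show ?thesis by (simp add: plus_prob_def)
qed

lemma plus_prob_nonneg: "0 \<le> plus_prob \<beta> s"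
  by (simp add: plus_prob_def add_pos_pos less_imp_le)

lemma plus_prob_le_1: "plus_prob \<beta> s \<le> 1"
  by (simp add: plus_prob_def add_pos_pos)

lemma plus_prob_le_half:
  assumes "0 \<le> \<beta>" "s \<le> 0"
  shows "plus_prob \<beta> s \<le> 1 / 2"
proof -
  have "1 \<le> exp (- 2 * \<beta> * of_int s)"
    using assms by (simp add: mult_nonneg_nonpos)
  then have "1 / (1 + exp (- 2 * \<beta> * of_int s)) \<le> 1 / 2"
    by (intro divide_left_mono) (auto intro: mult_pos_pos add_pos_pos)
  then show ?thesis by (simp only: plus_prob_eq)
qed

lemma plus_prob_le_exp:
  assumes "0 \<le> \<beta>" "s \<le> - 1"
  shows "plus_prob \<beta> s \<le> exp (- 2 * \<beta>)"
proof -
  have "\<beta> * of_int s \<le> \<beta> * (- 1)"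
    using assms by (intro mult_left_mono) auto
  then have "exp (2 * \<beta>) \<le> exp (- 2 * \<beta> * of_int s)" by simp
  then have "exp (2 * \<beta>) \<le> 1 + exp (- 2 * \<beta> * of_int s)" by linarith
  then have "plus_prob \<beta> s \<le> 1 / exp (2 * \<beta>)"
    unfolding plus_prob_eq by (intro divide_left_mono) (auto simp: add_pos_pos)
  then show ?thesis by (simp add: exp_minus inverse_eq_divide)
qed

section \<open>One update and its effect on the hull\<close>

lemma plus_set_update_at:
  assumes "\<sigma> \<in> configs n" "v \<in> lattice_verts n"
  shows "plus_set n (update_at (diagonal n) \<sigma> v False) = plus_set n \<sigma> - {v}"
    and "plus_set n (update_at (diagonal n) \<sigma> v True) =
      (if v \<in> diagonal n then plus_set n \<sigma> else insert v (plus_set n \<sigma>))"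
  using assms by (auto simp: plus_set_def update_at_def corrupt_def configs_def split: if_splits)

lemma update_at_configs:
  assumes "\<sigma> \<in> configs n" "v \<in> lattice_verts n"
  shows "update_at (diagonal n) \<sigma> v b \<in> configs n"
proof -
  have "diagonal n \<subseteq> lattice_verts n" by (auto simp: diagonal_def lattice_verts_def)
  with assms show ?thesis
    by (auto simp: configs_def update_at_def corrupt_def extensional_def split: if_splits)
qed

definition hull_size :: "nat \<Rightarrow> (nat \<times> nat \<Rightarrow> int) \<Rightarrow> nat" where
  "hull_size n \<sigma> = card (corner_hull n (plus_set n \<sigma>))"

text \<open>The expected change of \<open>f\<close> given that \<open>v\<close> is selected; the
  drift of a step is its average over the sites.\<close>

definition site_drift :: "nat \<Rightarrow> real \<Rightarrow> ((nat \<times> nat \<Rightarrow> int) \<Rightarrow> real) \<Rightarrow> (nat \<times> nat \<Rightarrow> int) \<Rightarrow> nat \<times> nat \<Rightarrow> real" where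
  "site_drift n \<beta> f \<sigma> v =
     (let p = plus_prob \<beta> (local_field (lattice_verts n) lattice_adj \<sigma> v)
      in p * f (update_at (diagonal n) \<sigma> v True) + (1 - p) * f (update_at (diagonal n) \<sigma> v False) - f \<sigma>)"

text \<open>Inside the hull only a minus update can matter, outside only a plus update. The error
  term is the largest possible hull size \<open>n\<^sup>2\<close> times the probability bound
  \<open>1 / n^8\<close> for a plus at a site with negative field.\<close>

lemma site_drift_hull_size_le:
  assumes \<sigma>: "\<sigma> \<in> configs n" and v: "v \<in> lattice_verts n" and \<beta>: "4 * ln (real n) \<le> \<beta>" and n: "1 \<le> n"
  defines "H \<equiv> corner_hull n (plus_set n \<sigma>)"
  shows "site_drift n \<beta> (\<lambda>\<sigma>. real (hull_size n \<sigma>)) \<sigma> v \<le>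
    indicator (addable H) v / 2 - indicator (removable H) v / 2 + 1 / real n ^ 6"
proof -
  obtain i j where ij: "v = (i, j)" by force
  let ?P = "plus_set n \<sigma>"
  let ?h = "\<lambda>P. real (card (corner_hull n P))"
  define p where "p = plus_prob \<beta> (local_field (lattice_verts n) lattice_adj \<sigma> v)"
  have p: "0 \<le> p" "p \<le> 1" by (simp_all add: p_def plus_prob_nonneg plus_prob_le_1)
  have \<beta>0: "0 \<le> \<beta>" using \<beta> n ln_ge_zero[of "real n"] by linarith
  have D: "site_drift n \<beta> (\<lambda>\<sigma>. real (hull_size n \<sigma>)) \<sigma> v =
      p * ?h (if v \<in> diagonal n then ?P else insert v ?P) + (1 - p) * ?h (?P - {v}) - ?h ?P"
    by (simp add: site_drift_def hull_size_def plus_set_update_at[OF \<sigma> v] p_def Let_def)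
  define \<epsilon> where "\<epsilon> = 1 / real n ^ 6"
  have err: "0 \<le> \<epsilon>" by (simp add: \<epsilon>_def)
  show ?thesis
  proof (cases "i < j")
    case False
    then have "corner_hull n ?P = corner_hull n (?P - {v})" "corner_hull n (insert v ?P) = corner_hull n ?P"
      by (intro hull_eqI; auto simp: ij)+
    moreover have "v \<notin> removable H"
      using False hull_upper[of i j n ?P] by (auto simp: ij removable_def H_def)
    ultimately show ?thesis unfolding D \<epsilon>_def[symmetric] using err by (simp add: algebra_simps)
  next
    case True
    then have nd: "v \<notin> diagonal n" by (auto simp: ij diagonal_def)
    have bd: "1 \<le> i" "j \<le> n" using v by (auto simp: ij lattice_verts_def)
    note field = local_field_upper[OF \<sigma> bd(1) True bd(2)]
    \<comment> \<open>With \<open>out_diag\<close>, this turns neighbours outside the hull into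
      non-plus sites, whether they lie above the diagonal or on it.\<close>
    have out: "u \<notin> ?P" if "u \<notin> H" "fst u < snd u" for u
    proof
      assume "u \<in> ?P"
      then have "u \<in> lattice_verts n" by (simp add: plus_set_def)
      then show False
        using that in_hull[of "fst u" "snd u" ?P n] \<open>u \<in> ?P\<close> by (auto simp: H_def lattice_verts_def)
    qed
    have out_diag: "(a, a) \<notin> ?P" for a
      using \<sigma> by (auto simp: configs_def plus_set_def diagonal_def lattice_verts_def)
    show ?thesis
    proof (cases "v \<in> H")
      case vH: True
      then have ins: "corner_hull n (insert v ?P) = corner_hull n ?P"
        by (intro hull_eqI) (auto simp: ij H_def)
      have rem_sub: "corner_hull n (?P - {v}) \<subseteq> H" unfolding H_def by (rule hull_mono) auto
      have nadd: "v \<notin> addable H" using vH by (auto simp: addable_def ij)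
      show ?thesis
      proof (cases "v \<in> removable H")
        case False
        have "?h (?P - {v}) \<le> ?h ?P" using rem_sub by (simp add: card_mono H_def)
        then have "(1 - p) * ?h (?P - {v}) \<le> (1 - p) * ?h ?P" using p by (intro mult_left_mono) auto
        then show ?thesis unfolding D \<epsilon>_def[symmetric] using nd False nadd ins err by (simp add: algebra_simps)
      next
        case rem: True
        have nb: "(i, j - 1) \<notin> H" "(i + 1, j) \<notin> H" using rem by (auto simp: removable_def ij)
        have "(i, j - 1) \<notin> ?P" "(i + 1, j) \<notin> ?P"
        proof -
          show "(i, j - 1) \<notin> ?P"
            using out[OF nb(1)] out_diag True by (cases "i = j - 1") auto
          show "(i + 1, j) \<notin> ?P"
            using out[OF nb(2)] out_diag True by (cases "i + 1 = j") auto
        qed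
        then have p2: "p \<le> 1 / 2"
          unfolding p_def ij by (intro plus_prob_le_half \<beta>0 field(1))
        \<comment> \<open>A removable corner is its own only generator: any other generator has
          \<open>a = i\<close> and \<open>b \<le> j - 1\<close>, or \<open>a \<ge> i + 1\<close>,
          and would put \<open>(i, j - 1)\<close> or \<open>(i + 1, j)\<close> in the hull.\<close>
        have "v \<notin> corner_hull n (?P - {v})"
        proof
          assume "v \<in> corner_hull n (?P - {v})"
          then obtain a b where ab: "(a, b) \<in> ?P" "(a, b) \<noteq> (i, j)" "a < b" "i \<le> a" "b \<le> j"
            by (auto simp: corner_hull_def ij)
          then have abH: "(a, b) \<in> corner_hull n ?P"
            using bd by (intro in_hull) auto
          show False
          proof (cases "a = i")
            case True
            then have "b \<le> j - 1" "j - 1 \<le> n" using ab bd by auto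
            then show False
              using True bd nb(1) hull_closed[OF abH, of i "j - 1"] by (auto simp: H_def)
          next
            case False
            then show False
              using ab bd nb(2) hull_closed[OF abH, of "i + 1" j] by (auto simp: H_def)
          qed
        qed
        then have "corner_hull n (?P - {v}) \<subset> H" using rem_sub vH by auto
        then have "card (corner_hull n (?P - {v})) < card H" unfolding H_def by (intro psubset_card_mono) auto
        then have "?h (?P - {v}) \<le> ?h ?P - 1" by (simp add: H_def)
        then have "(1 - p) * ?h (?P - {v}) \<le> (1 - p) * (?h ?P - 1)" using p by (intro mult_left_mono) auto
        then show ?thesis unfolding D \<epsilon>_def[symmetric] using nd rem nadd ins err p2 by (simp add: algebra_simps)
      qed
    next
      case vH: False
      then have nrem: "v \<notin> removable H" by (auto simp: removable_def ij)
      have PD: "?P - {v} = ?P" using out[OF vH] True by (auto simp: ij)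
      have D': "site_drift n \<beta> (\<lambda>\<sigma>. real (hull_size n \<sigma>)) \<sigma> v = p * (?h (insert v ?P) - ?h ?P)"
        unfolding D PD using nd by (simp add: algebra_simps)
      have nb: "(i, j - 1) \<notin> ?P" "(i + 1, j) \<notin> ?P"
      proof -
        have "(i, j - 1) \<notin> H" "(i + 1, j) \<notin> H"
          using vH bd hull_closed[of i "j - 1" n ?P i j] hull_closed[of "i + 1" j n ?P i j]
          by (auto simp: H_def ij)
        note nbH = this
        show "(i, j - 1) \<notin> ?P"
          using out[OF nbH(1)] out_diag True by (cases "i = j - 1") auto
        show "(i + 1, j) \<notin> ?P"
          using out[OF nbH(2)] out_diag True by (cases "i + 1 = j") auto
      qed
      show ?thesis
      proof (cases "v \<in> addable H")
        case add: True
        have p2: "p \<le> 1 / 2"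
          unfolding p_def ij using nb by (intro plus_prob_le_half \<beta>0 field(1))
        \<comment> \<open>Every site generated by \<open>(i, j)\<close>, other than itself, is
          already below \<open>(i - 1, j)\<close> or \<open>(i, j + 1)\<close> in the ideal.\<close>
        have "corner_hull n (insert v ?P) \<subseteq> insert v H"
        proof
          fix u assume u: "u \<in> corner_hull n (insert v ?P)"
          obtain k l where kl: "u = (k, l)" by force
          show "u \<in> insert v H"
          proof (cases "u \<in> H")
            case False
            then have "k \<le> i" "j \<le> l" "1 \<le> k" "l \<le> n"
              using u by (auto simp: kl ij corner_hull_def H_def)
            moreover have "(i - 1, j) \<in> H" "(i, j + 1) \<in> H" using add by (auto simp: addable_def ij)
            ultimately have "\<not> k \<le> i - 1" "\<not> j + 1 \<le> l"
              using False hull_closed[of "i - 1" j n ?P k l] hull_closed[of i "j + 1" n ?P k l]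
              by (auto simp: H_def kl)
            with \<open>k \<le> i\<close> \<open>j \<le> l\<close> have "k = i \<and> l = j" by linarith
            then show ?thesis by (simp add: kl ij)
          qed simp
        qed
        then have "card (corner_hull n (insert v ?P)) \<le> card (insert v H)"
          unfolding H_def by (intro card_mono) auto
        also have "\<dots> = card H + 1" using vH by (simp add: H_def)
        finally have "?h (insert v ?P) - ?h ?P \<le> 1" by (simp add: H_def)
        then have "p * (?h (insert v ?P) - ?h ?P) \<le> p * 1" using p by (intro mult_left_mono) auto
        then show ?thesis unfolding D' \<epsilon>_def[symmetric] using add nrem err p2 by simp
      next
        case nadd: False
        \<comment> \<open>One neighbour towards the corner is minus or missing, so the local field
          is at most -1.\<close>
        then have "(i - 1, j) \<notin> H \<or> (i, j + 1) \<notin> H" using vH by (auto simp: addable_def ij)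
        then have "(i - 1, j) \<notin> ?P \<or> (i, j + 1) \<notin> ?P"
          using out[of "(i - 1, j)"] out[of "(i, j + 1)"] True by (auto simp: less_imp_diff_less)
        then have "p \<le> exp (- 2 * \<beta>)"
          unfolding p_def ij by (intro plus_prob_le_exp \<beta>0 field(2) nb)
        also have "\<dots> \<le> exp (- (8 * ln (real n)))" using \<beta> by simp
        also have "\<dots> = 1 / real n ^ 8"
          using n exp_ln[of "real n ^ 8"] ln_realpow[of "real n" 8]
          by (simp add: exp_minus inverse_eq_divide del: exp_ln)
        finally have p8: "p \<le> 1 / real n ^ 8" .
        have "?h (insert v ?P) - ?h ?P \<le> real (n\<^sup>2)"
          using card_hull_le[of n "insert v ?P"] by (smt (verit) of_nat_0_le_iff of_nat_mono)
        then have "p * (?h (insert v ?P) - ?h ?P) \<le> p * real (n\<^sup>2)" using p by (intro mult_left_mono) auto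
        also have "\<dots> \<le> 1 / real n ^ 8 * real (n\<^sup>2)" using p8 by (intro mult_right_mono) auto
        also have "\<dots> = 1 / real n ^ 6" using n by (simp add: field_simps flip: power_add)
        finally show ?thesis unfolding D' using nadd nrem by simp
      qed
    qed
  qed
qed

section \<open>The potential\<close>

text \<open>A nonempty hull has at least one more removable than addable corner, which yields -1/2;
  the \<open>n\<^sup>2\<close> errors \<open>1 / n^6\<close> add up to
  \<open>1 / n^4\<close>.\<close>

lemma sum_site_drift_hull_size_le:
  assumes \<sigma>: "\<sigma> \<in> configs n" and \<beta>: "4 * ln (real n) \<le> \<beta>" and n: "1 \<le> n"
  shows "(\<Sum>v\<in>lattice_verts n. site_drift n \<beta> (\<lambda>\<sigma>. real (hull_size n \<sigma>)) \<sigma> v) \<le>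
    (if corner_hull n (plus_set n \<sigma>) = {} then 0 else - 1 / 2) + 1 / real n ^ 4"
proof -
  let ?V = "lattice_verts n"
  define H where "H = corner_hull n (plus_set n \<sigma>)"
  have rem: "removable H \<subseteq> H" and fin: "finite H"
    by (auto simp: removable_def H_def)
  have "addable H \<subseteq> (\<lambda>(i, j). (i + 1, j)) ` H"
    using hull_upper by (force simp: addable_def H_def image_iff)
  then have fin_add: "finite (addable H)" using fin by (auto intro: finite_subset)
  have "(\<Sum>v\<in>?V. site_drift n \<beta> (\<lambda>\<sigma>. real (hull_size n \<sigma>)) \<sigma> v) \<le>
      (\<Sum>v\<in>?V. indicator (addable H) v / 2 - indicator (removable H) v / 2 + 1 / real n ^ 6)"
    unfolding H_def by (intro sum_mono site_drift_hull_size_le \<sigma> \<beta> n)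
  also have "\<dots> = real (card (?V \<inter> addable H)) / 2 - real (card (?V \<inter> removable H)) / 2 + real (n\<^sup>2) * (1 / real n ^ 6)"
    by (simp add: sum.distrib sum_subtractf sum_divide_distrib[symmetric] indicator_def Int_def)
  also have "?V \<inter> removable H = removable H"
    using rem hull_subset[of n] by (auto simp: H_def)
  also have "real (n\<^sup>2) * (1 / real n ^ 6) = 1 / real n ^ 4"
    using n by (simp add: field_simps flip: power_add)
  also have "real (card (?V \<inter> addable H)) / 2 - real (card (removable H)) / 2 \<le> (if H = {} then 0 else - 1 / 2)"
  proof (cases "H = {}")
    case True
    then show ?thesis by (simp add: addable_def)
  next
    case False
    have "card (?V \<inter> addable H) \<le> card (addable H)"
      using fin_add by (intro card_mono) auto
    also have "\<dots> < card (removable H)"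
      using False card_addable_less_card_removable by (simp add: H_def)
    finally show ?thesis using False by simp
  qed
  finally show ?thesis by (simp add: H_def)
qed

section \<open>Symmetry under transposition\<close>

lemma swap_lattice_verts [simp]: "prod.swap v \<in> lattice_verts n \<longleftrightarrow> v \<in> lattice_verts n"
  by (cases v) (auto simp: lattice_verts_def)

lemma swap_diagonal [simp]: "prod.swap v \<in> diagonal n \<longleftrightarrow> v \<in> diagonal n"
  by (cases v) (auto simp: diagonal_def)

lemma bij_betw_swap_lattice_verts: "bij_betw prod.swap (lattice_verts n) (lattice_verts n)"
  by (rule bij_betw_byWitness[where f' = prod.swap]) (auto simp: lattice_verts_def)

lemma swap_configs: "\<sigma> \<in> configs n \<Longrightarrow> \<sigma> \<circ> prod.swap \<in> configs n"
  by (auto simp: configs_def extensional_def lattice_verts_def diagonal_def)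

lemma update_at_swap:
  "update_at (diagonal n) \<sigma> v b \<circ> prod.swap = update_at (diagonal n) (\<sigma> \<circ> prod.swap) (prod.swap v) b"
  by (rule ext) (auto simp: update_at_def corrupt_def)

lemma local_field_swap:
  "local_field (lattice_verts n) lattice_adj \<sigma> v =
   local_field (lattice_verts n) lattice_adj (\<sigma> \<circ> prod.swap) (prod.swap v)"
  unfolding local_field_def
proof (rule sum.reindex_bij_witness[of _ prod.swap prod.swap])
qed (cases v; auto simp: lattice_adj_iff)+

lemma site_drift_swap:
  "site_drift n \<beta> (\<lambda>\<sigma>. f (\<sigma> \<circ> prod.swap)) \<sigma> v = site_drift n \<beta> f (\<sigma> \<circ> prod.swap) (prod.swap v)"
  by (simp add: site_drift_def update_at_swap local_field_swap[of n \<sigma> v])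

section \<open>Drift of the potential of both triangles\<close>

definition potential :: "nat \<Rightarrow> (nat \<times> nat \<Rightarrow> int) \<Rightarrow> real" where
  "potential n \<sigma> = real (hull_size n \<sigma>) + real (hull_size n (\<sigma> \<circ> prod.swap))"

lemma potential_nonneg: "0 \<le> potential n \<sigma>"
  by (simp add: potential_def)

lemma potential_le: "potential n \<sigma> \<le> 2 * real n ^ 2"
proof -
  have "real (hull_size n \<sigma>) \<le> (real n)\<^sup>2" for \<sigma>
    unfolding hull_size_def of_nat_power[symmetric] of_nat_le_iff by (rule card_hull_le)
  from this[of \<sigma>] this[of "\<sigma> \<circ> prod.swap"] show ?thesis unfolding potential_def by linarith
qed

text \<open>A plus spin is off the diagonal, so one of the two hulls is nonempty and
  \<open>n \<ge> 2\<close>. The two errors are then at most 1/8 together, leaving -3/8.\<close>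

lemma sum_site_drift_potential_le:
  assumes \<sigma>: "\<sigma> \<in> configs n" and \<beta>: "4 * ln (real n) \<le> \<beta>"
    and v: "v \<in> lattice_verts n" "\<sigma> v = 1"
  shows "(\<Sum>v\<in>lattice_verts n. site_drift n \<beta> (potential n) \<sigma> v) \<le> - 1 / 4"
proof -
  let ?\<tau> = "\<sigma> \<circ> prod.swap"
  let ?h = "\<lambda>\<sigma>. real (hull_size n \<sigma>)"
  obtain i j where ij: "v = (i, j)" by force
  have "i \<noteq> j" "1 \<le> i" "i \<le> n" "1 \<le> j" "j \<le> n"
    using \<sigma> v by (auto simp: ij configs_def diagonal_def lattice_verts_def)
  then have n: "2 \<le> n" by linarith
  have upper: "corner_hull n (plus_set n \<sigma>) \<noteq> {}" if "i < j"
    using in_hull[of i j "plus_set n \<sigma>" n] v that by (auto simp: ij plus_set_def lattice_verts_def)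
  have lower: "corner_hull n (plus_set n ?\<tau>) \<noteq> {}" if "j < i"
    using in_hull[of j i "plus_set n ?\<tau>" n] v that by (auto simp: ij plus_set_def lattice_verts_def)
  have "(\<Sum>v\<in>lattice_verts n. site_drift n \<beta> (potential n) \<sigma> v) =
      (\<Sum>v\<in>lattice_verts n. site_drift n \<beta> ?h \<sigma> v) +
      (\<Sum>v\<in>lattice_verts n. site_drift n \<beta> (\<lambda>\<sigma>. ?h (\<sigma> \<circ> prod.swap)) \<sigma> v)"
    unfolding sum.distrib[symmetric]
    by (rule sum.cong) (simp_all add: site_drift_def potential_def Let_def algebra_simps)
  also have "(\<Sum>v\<in>lattice_verts n. site_drift n \<beta> (\<lambda>\<sigma>. ?h (\<sigma> \<circ> prod.swap)) \<sigma> v) =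
      (\<Sum>v\<in>lattice_verts n. site_drift n \<beta> ?h ?\<tau> v)"
    unfolding site_drift_swap[of n \<beta> ?h] by (rule sum.reindex_bij_betw[OF bij_betw_swap_lattice_verts])
  also have "(\<Sum>v\<in>lattice_verts n. site_drift n \<beta> ?h \<sigma> v) + \<dots> \<le>
      ((if corner_hull n (plus_set n \<sigma>) = {} then 0 else - 1 / 2) + 1 / real n ^ 4) +
      ((if corner_hull n (plus_set n ?\<tau>) = {} then 0 else - 1 / 2) + 1 / real n ^ 4)"
    using n by (intro add_mono sum_site_drift_hull_size_le \<sigma> swap_configs \<beta>) auto
  also have "\<dots> \<le> - 1 / 2 + 2 * (1 / real n ^ 4)"
    using upper lower \<open>i \<noteq> j\<close> by (cases "i < j") auto
  also have "\<dots> \<le> - 1 / 2 + 2 * (1 / 2 ^ 4)"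
    using n by (intro add_left_mono mult_left_mono divide_left_mono power_mono) auto
  also have "\<dots> \<le> - 1 / 4" by simp
  finally show ?thesis .
qed

text \<open>Averaging over the selected site turns the sum of the site drifts into the one-step
  drift. Nonnegativity is recorded because \<open>ennreal\<close> sends negative reals to 0, so sums
  split only for nonnegative terms.\<close>

lemma nn_integral_corrupted_glauber_step:
  assumes f: "\<And>\<sigma>. 0 \<le> f \<sigma>" and n: "1 \<le> n"
  shows "0 \<le> f \<sigma> + (\<Sum>v\<in>lattice_verts n. site_drift n \<beta> f \<sigma> v) / real n ^ 2" (is ?nonneg)
    and "(\<integral>\<^sup>+\<sigma>'. ennreal (f \<sigma>') \<partial>measure_pmf
      (corrupted_glauber_step (lattice_verts n) lattice_adj \<beta> (diagonal n) \<sigma>)) =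
    ennreal (f \<sigma> + (\<Sum>v\<in>lattice_verts n. site_drift n \<beta> f \<sigma> v) / real n ^ 2)" (is ?integral)
proof -
  let ?V = "lattice_verts n"
  define p where "p v = plus_prob \<beta> (local_field ?V lattice_adj \<sigma> v)" for v
  define u where "u v b = f (update_at (diagonal n) \<sigma> v b)" for v b
  have p: "0 \<le> p v" "p v \<le> 1" for v by (simp_all add: p_def plus_prob_nonneg plus_prob_le_1)
  have u: "0 \<le> u v b" for v b by (simp add: u_def f)
  have ne: "?V \<noteq> {}" using n by (simp add: lattice_verts_def)
  define m where "m v = p v * u v True + (1 - p v) * u v False" for v
  have m: "0 \<le> m v" for v using p[of v] u[of v] by (simp add: m_def)
  have "(\<Sum>v\<in>?V. m v) = real (n\<^sup>2) * f \<sigma> + (\<Sum>v\<in>?V. site_drift n \<beta> f \<sigma> v)"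
    by (simp add: site_drift_def Let_def sum_subtractf m_def p_def u_def)
  then have mean: "(\<Sum>v\<in>?V. m v) / real (n\<^sup>2) = f \<sigma> + (\<Sum>v\<in>?V. site_drift n \<beta> f \<sigma> v) / real n ^ 2"
    using n by (simp add: add_divide_distrib)
  show ?nonneg
    unfolding mean[symmetric] using m by (intro divide_nonneg_nonneg sum_nonneg) auto
  have "(\<integral>\<^sup>+\<sigma>'. ennreal (f \<sigma>') \<partial>measure_pmf
      (corrupted_glauber_step ?V lattice_adj \<beta> (diagonal n) \<sigma>)) =
      (\<integral>\<^sup>+v. \<integral>\<^sup>+b. ennreal (u v b) \<partial>measure_pmf (bernoulli_pmf (p v)) \<partial>measure_pmf (pmf_of_set ?V))"
    by (simp add: corrupted_glauber_step_def glauber_step_def u_def p_def update_at_def del: nn_integral_bernoulli_pmf)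
  also have "\<dots> = (\<integral>\<^sup>+v. ennreal (m v) \<partial>measure_pmf (pmf_of_set ?V))"
  proof (rule nn_integral_cong)
    fix v
    have "(\<integral>\<^sup>+b. ennreal (u v b) \<partial>measure_pmf (bernoulli_pmf (p v))) =
        ennreal (u v True) * ennreal (p v) + ennreal (u v False) * ennreal (1 - p v)"
      by (rule nn_integral_bernoulli_pmf) (simp_all add: p)
    also have "\<dots> = ennreal (m v)"
      using p u by (simp add: m_def ennreal_mult' ennreal_plus mult.commute)
    finally show "(\<integral>\<^sup>+b. ennreal (u v b) \<partial>measure_pmf (bernoulli_pmf (p v))) = ennreal (m v)" .
  qed
  also have "\<dots> = ennreal ((\<Sum>v\<in>?V. m v) / real (n\<^sup>2))"
    using n m by (subst nn_integral_pmf_of_set[OF ne])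
      (simp_all add: sum_ennreal divide_ennreal[symmetric] sum_nonneg ennreal_of_nat_eq_real_of_nat del: of_nat_power)
  finally show ?integral by (simp only: mean)
qed

lemma set_corrupted_glauber_step:
  assumes "\<sigma> \<in> configs n" "1 \<le> n"
  shows "set_pmf (corrupted_glauber_step (lattice_verts n) lattice_adj \<beta> (diagonal n) \<sigma>) \<subseteq> configs n"
proof -
  have "lattice_verts n \<noteq> {}" using assms(2) by (simp add: lattice_verts_def)
  then show ?thesis
    using update_at_configs[OF assms(1)]
    by (auto simp: corrupted_glauber_step_def glauber_step_def set_pmf_of_set update_at_def)
qed

section \<open>The bound on the expected hitting time\<close>

theorem theorem4p3:
  shows "\<exists>C::real. 0 < C \<and>
    (\<forall>(n::nat) (\<beta>::real). 1 \<le> n \<longrightarrow> 4 * ln (real n) \<le> \<beta> \<longrightarrow>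
      expected_hitting_time
        (corrupted_glauber_step (lattice_verts n) lattice_adj \<beta> (diagonal n))
        (corrupt (diagonal n) (const_config (lattice_verts n) 1))
        (const_config (lattice_verts n) (-1))
      \<le> ennreal (C * real n ^ 5))"
proof (intro exI[of _ 8] conjI allI impI)
  fix n :: nat and \<beta> :: real
  assume n: "1 \<le> n" and \<beta>: "4 * ln (real n) \<le> \<beta>"
  let ?K = "corrupted_glauber_step (lattice_verts n) lattice_adj \<beta> (diagonal n)"
  let ?x = "corrupt (diagonal n) (const_config (lattice_verts n) 1)"
  let ?y = "const_config (lattice_verts n) (-1)"
  let ?E = "expected_hitting_time ?K ?x ?y"
  \<comment> \<open>The summed drift -1/4 is divided by the \<open>n\<^sup>2\<close> sites. Dividing
    the potential bound \<open>2 * n^2\<close> by \<open>?c\<close> gives \<open>8 * n^4\<close>,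
    whence the witness 8.\<close>
  let ?c = "1 / (4 * real n ^ 2)"
  \<comment> \<open>The value \<open>\<top>\<close> makes the drift inequality trivial off
    \<open>configs n\<close>; invariance of \<open>configs n\<close> keeps it out of the integrals
    from inside.\<close>
  define F where "F \<sigma> = (if \<sigma> \<in> configs n then ennreal (potential n \<sigma>) else \<top>)" for \<sigma>
  have "(\<integral>\<^sup>+\<sigma>'. F \<sigma>' \<partial>measure_pmf (?K \<sigma>)) + ennreal ?c \<le> F \<sigma>" if "\<sigma> \<noteq> ?y" for \<sigma>
  proof (cases "\<sigma> \<in> configs n")
    case True
    have "\<exists>v\<in>lattice_verts n. \<sigma> v \<noteq> -1"
    proof (rule ccontr)
      assume "\<not> ?thesis"
      then have "\<sigma> = ?y"
        using True by (intro ext) (auto simp: const_config_def configs_def extensional_def)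
      with that show False by simp
    qed
    then obtain v where v: "v \<in> lattice_verts n" "\<sigma> v = 1"
      using True by (auto simp: configs_def)
    define D where "D = (\<Sum>v\<in>lattice_verts n. site_drift n \<beta> (potential n) \<sigma> v)"
    have "D \<le> - 1 / 4" unfolding D_def by (rule sum_site_drift_potential_le[OF True \<beta> v])
    then have "D / real n ^ 2 \<le> (- 1 / 4) / real n ^ 2" by (rule divide_right_mono) simp
    then have D: "potential n \<sigma> + D / real n ^ 2 + ?c \<le> potential n \<sigma>" by simp
    have "(\<integral>\<^sup>+\<sigma>'. F \<sigma>' \<partial>measure_pmf (?K \<sigma>)) = (\<integral>\<^sup>+\<sigma>'. ennreal (potential n \<sigma>') \<partial>measure_pmf (?K \<sigma>))"
      using set_corrupted_glauber_step[OF True n, of \<beta>]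
      by (intro nn_integral_cong_AE) (auto simp: AE_measure_pmf_iff F_def)
    also have "\<dots> = ennreal (potential n \<sigma> + D / real n ^ 2)"
      unfolding D_def by (rule nn_integral_corrupted_glauber_step(2)[OF potential_nonneg n])
    finally have "(\<integral>\<^sup>+\<sigma>'. F \<sigma>' \<partial>measure_pmf (?K \<sigma>)) + ennreal ?c = ennreal (potential n \<sigma> + D / real n ^ 2) + ennreal ?c"
      by simp
    also have "\<dots> \<le> ennreal (potential n \<sigma>)"
      using D nn_integral_corrupted_glauber_step(1)[of "potential n" n \<sigma> \<beta>, OF potential_nonneg n]
      by (simp add: D_def ennreal_leI flip: ennreal_plus)
    finally show ?thesis using True by (simp add: F_def)
  qed (simp add: F_def)
  then have "ennreal ?c * ?E \<le> F ?x"
    by (rule expected_hitting_time_drift)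
  also have "?x \<in> configs n"
    by (auto simp: configs_def corrupt_def const_config_def extensional_def diagonal_def lattice_verts_def)
  then have "F ?x \<le> ennreal (2 * real n ^ 2)"
    by (simp add: F_def ennreal_leI potential_le)
  finally have cE: "ennreal ?c * ?E \<le> ennreal (2 * real n ^ 2)" .
  \<comment> \<open>As \<open>?E\<close> might a priori be infinite, the inequality is multiplied by
    the inverse of \<open>?c\<close> inside \<open>ennreal\<close>.\<close>
  have "?E = ennreal (4 * real n ^ 2 * ?c) * ?E"
    using n by simp
  also have "\<dots> = ennreal (4 * real n ^ 2) * (ennreal ?c * ?E)"
    by (subst ennreal_mult) (simp_all add: mult.assoc)
  also have "\<dots> \<le> ennreal (4 * real n ^ 2) * ennreal (2 * real n ^ 2)"
    by (intro mult_left_mono cE) simp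
  also have "\<dots> = ennreal (8 * real n ^ 4)"
    by (simp flip: ennreal_mult power_add)
  also have "\<dots> \<le> ennreal (8 * real n ^ 5)"
    using n by (intro ennreal_leI mult_left_mono power_increasing) auto
  finally show "?E \<le> ennreal (8 * real n ^ 5)" .
qed simp

end
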